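(* Let $\boldsymbol{B}\in\mathbb{R}^{n\times n}$ be an index matrix that is upper triangular and invertible, i.e. without zeroes on the diagonal. Let $\boldsymbol{g}=(g_1,\ldots,g_n)'\in R_{\boldsymbol{B}}$, let $\boldsymbol{c}\in\mathbb{R}^{1\times n}$, and let $f$ be a measurable real-valued function defined in a neighbourhood of infinity. Then $f\in GRV(\boldsymbol{g})$ with $\boldsymbol{g}$-index $\boldsymbol{c}$ if and only if there exists a constant $C\in\mathbb{R}$ such that $$f(t)=C+\boldsymbol{c}\boldsymbol{B}^{-1}\boldsymbol{g}(t)+o(g_n(t)),\qquad t\to\infty.$$
   Context: Limit relations are as $t\to\infty$; measurability is Lebesgue. A real function is defined in a neighbourhood of infinity if its domain contains some $[t_0,\infty)$; it is eventually of constant sign if it is either strictly positive for all large $t$ or strictly negative for all large $t$. A rate vector of length $n$ is a column vector $\boldsymbol{g}=(g_1,\ldots,g_n)'$ of real-valued functions defined in a neighbourhood of infinity, each eventually of constant sign, with $g_{i+1}(t)=o(g_i(t))$ for every $i\in\{1,\ldots,n-1\}$; $o(g_n(t))$ means $o(|g_n(t)|)$, componentwise for vectors. For a square matrix $\boldsymbol{B}$ and $x>0$, $x^{\boldsymbol{B}}=\exp\{(\log x)\boldsymbol{B}\}$. An index matrix is an upper triangular $\boldsymbol{B}\in\mathbb{R}^{n\times n}$ whose diagonal elements are non-increasing and all of whose eigenvalues, except possibly the smallest one, have geometric multiplicity one. A rate vector $\boldsymbol{g}$ is regularly varying with index matrix $\boldsymbol{B}$, written $\boldsymbol{g}\in R_{\boldsymbol{B}}$,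 if $\boldsymbol{g}$ is measurable and $\boldsymbol{g}(xt)=x^{\boldsymbol{B}}\boldsymbol{g}(t)+o(g_n(t))$ for every $x\in(0,\infty)$. For $\boldsymbol{g}\in R_{\boldsymbol{B}}$, a measurable real-valued function $f$ defined in a neighbourhood of infinity is generalised regularly varying with rate vector $\boldsymbol{g}$ and $\boldsymbol{g}$-index $\boldsymbol{c}\in\mathbb{R}^{1\times n}$, written $f\in GRV(\boldsymbol{g})$, if for every $x\in(0,\infty)$, $f(xt)=f(t)+\boldsymbol{h}(x)\boldsymbol{g}(t)+o(g_n(t))$ with $\boldsymbol{h}(x)=\boldsymbol{c}\int_1^x y^{\boldsymbol{B}}y^{-1}\,\mathrm{d}y$. *)

theory Defs
  imports "HOL-Analysis.Analysis" "HOL-Library.Landau_Symbols"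
begin

text \<open>
  Vectors of length \<open>n\<close> are indexed by an arbitrary type of class \<open>{finite, linorder}\<close>, which plays
  the role of \<open>{1, ..., n}\<close> with its usual order; \<open>Max UNIV\<close> is the last index \<open>n\<close>.
  Row vectors are also elements of \<open>real ^ 'n\<close>, acting by \<open>v*\<close> on matrices and by \<open>\<bullet>\<close> on columns.
\<close>

abbreviation last_ix :: "'n::{finite,linorder}" where
  "last_ix \<equiv> Max UNIV"

definition is_succ_ix :: "'n::{finite,linorder} \<Rightarrow> 'n::{finite,linorder} \<Rightarrow> bool" where
  "is_succ_ix i j \<longleftrightarrow> i < j \<and> {i<..<j} = {}"

primrec matrix_pow :: "real ^ 'n ^ 'n \<Rightarrow> nat \<Rightarrow> real ^ 'n ^ 'n" where
  "matrix_pow A 0 = mat 1"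
| "matrix_pow A (Suc k) = A ** matrix_pow A k"

text \<open>The type of matrices is not an instance of \<open>real_normed_algebra_1\<close>, so \<open>exp\<close> does not apply.\<close>

definition matrix_exp :: "real ^ 'n ^ 'n \<Rightarrow> real ^ 'n ^ 'n" where
  "matrix_exp A = (\<Sum>k. matrix_pow A k /\<^sub>R fact k)"

definition rpow_matrix :: "real \<Rightarrow> real ^ 'n ^ 'n \<Rightarrow> real ^ 'n ^ 'n" where
  "rpow_matrix x B = matrix_exp (ln x *\<^sub>R B)"

definition eigenspace :: "real ^ 'n ^ 'n \<Rightarrow> real \<Rightarrow> (real ^ 'n) set" where
  "eigenspace B l = {v. B *v v = l *\<^sub>R v}"

definition is_eigenvalue :: "real ^ 'n ^ 'n \<Rightarrow> real \<Rightarrow> bool" where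
  "is_eigenvalue B l \<longleftrightarrow> (\<exists>v. v \<noteq> 0 \<and> B *v v = l *\<^sub>R v)"

text \<open>
  Real eigenvalues and real eigenspaces suffice below: all complex eigenvalues of a real upper
  triangular matrix are real, and passing to the complex numbers does not change the dimensions of
  their eigenspaces.
\<close>

definition index_matrix :: "real ^ 'n::{finite,linorder} ^ 'n::{finite,linorder} \<Rightarrow> bool" where
  "index_matrix B \<longleftrightarrow>
     (\<forall>i j. j < i \<longrightarrow> B $ i $ j = 0) \<and>
     (\<forall>i j. i \<le> j \<longrightarrow> B $ j $ j \<le> B $ i $ i) \<and>
     (\<forall>l. is_eigenvalue B l \<and> (\<exists>m. is_eigenvalue B m \<and> m < l) \<longrightarrow> dim (eigenspace B l) = 1)"

text \<open>
  A function defined in a neighbourhood of infinity is represented by a total function whose values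
  outside some \<open>{t0..}\<close> are irrelevant. Accordingly, measurability is only required of its
  restriction to such a half-line.
\<close>

definition measurable_near_infinity :: "(real \<Rightarrow> 'a::topological_space) \<Rightarrow> bool" where
  "measurable_near_infinity f \<longleftrightarrow> (\<exists>t0. f \<in> borel_measurable (lebesgue_on {t0..}))"

definition eventually_const_sign :: "(real \<Rightarrow> real) \<Rightarrow> bool" where
  "eventually_const_sign f \<longleftrightarrow> (\<forall>\<^sub>F t in at_top. f t > 0) \<or> (\<forall>\<^sub>F t in at_top. f t < 0)"

definition rate_vector :: "(real \<Rightarrow> real ^ 'n::{finite,linorder}) \<Rightarrow> bool" where
  "rate_vector g \<longleftrightarrow>
     (\<forall>i. eventually_const_sign (\<lambda>t. g t $ i)) \<and>
     (\<forall>i j. is_succ_ix i j \<longrightarrow> (\<lambda>t. g t $ j) \<in> o[at_top](\<lambda>t. g t $ i))"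

definition regularly_varying ::
    "real ^ 'n::{finite,linorder} ^ 'n::{finite,linorder} \<Rightarrow> (real \<Rightarrow> real ^ 'n::{finite,linorder}) \<Rightarrow> bool" where
  "regularly_varying B g \<longleftrightarrow>
     index_matrix B \<and> rate_vector g \<and> measurable_near_infinity g \<and>
     (\<forall>x>0. \<forall>i. (\<lambda>t. (g (x * t) - rpow_matrix x B *v g t) $ i) \<in> o[at_top](\<lambda>t. g t $ last_ix))"

text \<open>
  The integral is the oriented interval integral, so that for \<open>x < 1\<close> it is minus the integral over
  the interval from \<open>x\<close> to \<open>1\<close>.
\<close>

definition grv_h :: "real ^ 'n ^ 'n \<Rightarrow> real ^ 'n \<Rightarrow> real \<Rightarrow> real ^ 'n" where
  "grv_h B c x = c v* (LBINT y=ereal 1..ereal x. rpow_matrix y B /\<^sub>R y)"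

text \<open>Only meaningful for \<open>g\<close> regularly varying with index matrix \<open>B\<close>; \<open>c\<close> is the \<open>g\<close>-index.\<close>

definition GRV ::
    "real ^ 'n::{finite,linorder} ^ 'n::{finite,linorder} \<Rightarrow> (real \<Rightarrow> real ^ 'n::{finite,linorder}) \<Rightarrow> real ^ 'n::{finite,linorder} \<Rightarrow> (real \<Rightarrow> real) \<Rightarrow> bool" where
  "GRV B g c f \<longleftrightarrow>
     measurable_near_infinity f \<and>
     (\<forall>x>0. (\<lambda>t. f (x * t) - f t - grv_h B c x \<bullet> g t) \<in> o[at_top](\<lambda>t. g t $ last_ix))"

end

(*
  Since y^B / y is the derivative of B^-1 y^B, the function h equals c B^-1 (x^B - I); hence f is in
  GRV(g) iff phi = f - c B^-1 g satisfies phi(xt) - phi(t) = o(g_n(t)) for every x > 0. As B is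
  upper triangular, g_n is regularly varying with index b = B_nn, and b is nonzero as B is invertible.
  If b < 0, then g_n(2^k t) decays geometrically in k, so phi(2^k t) converges as k -> oo with an
  error o(g_n(t)), and the limit does not depend on t because phi(xt) - phi(t) -> 0.
  If b > 0, measurability makes the increments of phi and of log |g_n| uniformly small for x in
  [1,2] (uniform convergence theorem). Summing the increments of phi along t, 2t, 4t, ... and
  comparing with the geometric growth of g_n then gives phi = o(g_n).
*)
theory Submission
  imports Defs
begin

section \<open>The matrix exponential and the powers \<open>x^B\<close>\<close>

lemma linear_matrix_mult_left: "linear (\<lambda>X :: real ^ 'm ^ 'n. (A :: real ^ 'n ^ 'k) ** X)"
  by (rule linearI)
     (auto simp: matrix_matrix_mult_def vec_eq_iff sum.distrib distrib_left sum_distrib_left mult_ac)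

text \<open>\<open>K\<close> bounds left multiplication by \<open>A\<close> as a linear operator.
  The norm is the Euclidean norm of the entries, for which \<open>mat 1\<close> need not have norm
  1, so its norm remains as a factor.\<close>

lemma norm_matrix_pow_le:
  fixes A :: "real ^ 'n ^ 'n"
  obtains K where "K \<ge> 0" "\<And>k. norm (matrix_pow A k) \<le> K ^ k * norm (mat 1 :: real ^ 'n ^ 'n)"
proof -
  have "bounded_linear (\<lambda>X :: real ^ 'n ^ 'n. A ** X)"
    using linear_matrix_mult_left linear_conv_bounded_linear by blast
  then obtain K where K: "K \<ge> 0" "\<And>X :: real ^ 'n ^ 'n. norm (A ** X) \<le> norm X * K"
    using bounded_linear.nonneg_bounded by blast
  have "norm (matrix_pow A k) \<le> K ^ k * norm (mat 1 :: real ^ 'n ^ 'n)" for k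
  proof (induction k)
    case (Suc k)
    have "norm (matrix_pow A (Suc k)) \<le> norm (matrix_pow A k) * K" using K(2) by simp
    also have "\<dots> \<le> K ^ k * norm (mat 1 :: real ^ 'n ^ 'n) * K"
      using Suc K(1) by (rule mult_right_mono)
    finally show ?case by (simp add: mult_ac)
  qed simp
  with K(1) show ?thesis by (rule that)
qed

lemma matrix_pow_scaleR: "matrix_pow (s *\<^sub>R A) k = s ^ k *\<^sub>R matrix_pow A k"
  by (induction k) (simp_all add: scalar_matrix_assoc[symmetric] matrix_scalar_ac)

text \<open>The series is dominated by a multiple of the scalar exponential series of
  \<open>K\<close>.\<close>

lemma summable_matrix_exp:
  fixes A :: "real ^ 'n ^ 'n"
  shows "summable (\<lambda>k. matrix_pow A k /\<^sub>R fact k)"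
proof -
  obtain K where K: "K \<ge> 0" "\<And>k. norm (matrix_pow A k) \<le> K ^ k * norm (mat 1 :: real ^ 'n ^ 'n)"
    using norm_matrix_pow_le by blast
  have "summable (\<lambda>k. K ^ k /\<^sub>R fact k * norm (mat 1 :: real ^ 'n ^ 'n))"
    by (intro summable_mult2 summable_exp_generic)
  then show ?thesis
    by (rule summable_comparison_test') (use K(2) in \<open>simp add: divide_simps\<close>)
qed

lemma bounded_linear_matrix_nth: "bounded_linear (\<lambda>X :: real ^ 'n ^ 'm. X $ i $ j)"
  by (rule bounded_linear_compose[OF bounded_linear_vec_nth bounded_linear_vec_nth])

lemma matrix_exp_nth:
  fixes A :: "real ^ 'n ^ 'n"
  shows "matrix_exp A $ i $ j = (\<Sum>k. matrix_pow A k $ i $ j / fact k)"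
  using bounded_linear.suminf[OF bounded_linear_matrix_nth summable_matrix_exp, of A]
  by (simp add: matrix_exp_def divide_inverse_commute)

lemma summable_matrix_exp_nth:
  fixes A :: "real ^ 'n ^ 'n"
  shows "summable (\<lambda>k. matrix_pow A k $ i $ j / fact k)"
  using bounded_linear.summable[OF bounded_linear_matrix_nth summable_matrix_exp, of A]
  by (simp add: divide_inverse_commute)

lemma has_vector_derivative_vec_nthI:
  fixes f :: "real \<Rightarrow> 'a::real_normed_vector ^ 'n"
  assumes "\<And>i. ((\<lambda>s. f s $ i) has_vector_derivative f' $ i) (at x within S)"
  shows "(f has_vector_derivative f') (at x within S)"
  using assms unfolding has_vector_derivative_def has_derivative_within
  by (auto intro!: vec_tendstoI bounded_linear_scaleR_left)

text \<open>Each entry of \<open>matrix_exp (s *\<^sub>R B)\<close> is an everywhere convergent real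
  power series in \<open>s\<close>, so it may be differentiated term by term.\<close>

lemma has_vector_derivative_matrix_exp_scaleR:
  fixes B :: "real ^ 'n ^ 'n"
  shows "((\<lambda>s. matrix_exp (s *\<^sub>R B)) has_vector_derivative B ** matrix_exp (s *\<^sub>R B)) (at s)"
proof (intro has_vector_derivative_vec_nthI)
  fix i j
  define c where "c k = matrix_pow B k $ i $ j / fact k" for k
  have exp_eq: "matrix_exp (s *\<^sub>R B) $ l $ j = (\<Sum>k. matrix_pow B k $ l $ j / fact k * s ^ k)" for s l
    by (simp add: matrix_exp_nth matrix_pow_scaleR mult_ac)
  have summ: "summable (\<lambda>k. matrix_pow B k $ l $ j / fact k * s ^ k)" for s l
    using summable_matrix_exp_nth[of "s *\<^sub>R B" l j] by (simp add: matrix_pow_scaleR mult_ac)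
  have "((\<lambda>s. \<Sum>k. c k * s ^ k) has_field_derivative (\<Sum>k. diffs c k * s ^ k)) (at s)"
    by (rule termdiffs_strong_converges_everywhere) (use summ in \<open>simp add: c_def\<close>)
  \<comment> \<open>The factor \<open>Suc k\<close> from \<open>diffs\<close> cancels against
    \<open>fact (Suc k)\<close>; the extra factor \<open>B\<close> of
    \<open>matrix_pow B (Suc k)\<close> becomes the sum over \<open>l\<close>.\<close>
  also have "(\<Sum>k. diffs c k * s ^ k) = (\<Sum>k. \<Sum>l\<in>UNIV. B $ i $ l * (matrix_pow B k $ l $ j / fact k * s ^ k))"
    by (rule suminf_cong)
       (simp add: diffs_def c_def matrix_matrix_mult_def sum_distrib_left sum_distrib_right
          sum_divide_distrib divide_simps mult_ac)
  also have "\<dots> = (\<Sum>l\<in>UNIV. B $ i $ l * (\<Sum>k. matrix_pow B k $ l $ j / fact k * s ^ k))"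
    by (subst suminf_sum) (intro summable_mult summ sum.cong refl suminf_mult)+
  also have "\<dots> = (B ** matrix_exp (s *\<^sub>R B)) $ i $ j"
    by (simp add: exp_eq matrix_matrix_mult_def)
  finally show "((\<lambda>s. matrix_exp (s *\<^sub>R B) $ i $ j) has_vector_derivative
      (B ** matrix_exp (s *\<^sub>R B)) $ i $ j) (at s)"
    by (simp add: exp_eq c_def has_real_derivative_iff_has_vector_derivative)
qed

lemma has_vector_derivative_rpow_matrix:
  assumes "x > 0"
  shows "((\<lambda>y. rpow_matrix y B) has_vector_derivative (B ** rpow_matrix x B) /\<^sub>R x) (at x within S)"
  using vector_diff_chain_at[of ln "inverse x" x, OF _ has_vector_derivative_matrix_exp_scaleR, of B] assms
  by (auto simp: rpow_matrix_def o_def has_real_derivative_iff_has_vector_derivative[symmetric]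
      intro!: has_vector_derivative_at_within[of _ _ x S] DERIV_ln)

lemma rpow_matrix_one:
  fixes B :: "real ^ 'n ^ 'n"
  shows "rpow_matrix 1 B = mat 1"
proof -
  have "matrix_pow (0 :: real ^ 'n ^ 'n) k /\<^sub>R fact k = (if k = 0 then mat 1 else 0)" for k :: nat
    by (cases k) (auto simp: matrix_matrix_mult_def vec_eq_iff)
  then have "matrix_exp (0 :: real ^ 'n ^ 'n) = (\<Sum>k. if k = 0 then mat 1 else 0)"
    by (simp only: matrix_exp_def)
  also have "\<dots> = mat 1"
    by (subst suminf_finite[of "{0}"]) auto
  finally show ?thesis by (simp add: rpow_matrix_def)
qed

section \<open>The integral that defines h\<close>

lemma matrix_inv_cancel:
  assumes "invertible A"
  shows "A ** matrix_inv A = mat 1" "matrix_inv A ** A = mat 1"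
  using someI_ex[OF assms[unfolded invertible_def]] by (auto simp: matrix_inv_def)

text \<open>Fundamental theorem of calculus: differentiating \<open>rpow_matrix y B\<close> produces
  a factor \<open>B\<close>, which \<open>matrix_inv B\<close> removes.\<close>

lemma interval_integral_rpow_matrix:
  fixes B :: "real ^ 'n ^ 'n"
  assumes "invertible B" "x > 0"
  shows "(LBINT y=ereal 1..ereal x. rpow_matrix y B /\<^sub>R y) = matrix_inv B ** (rpow_matrix x B - mat 1)"
proof -
  have lin: "bounded_linear (\<lambda>X. matrix_inv B ** X)"
    using linear_matrix_mult_left linear_conv_bounded_linear by blast
  have deriv: "((\<lambda>y. matrix_inv B ** rpow_matrix y B) has_vector_derivative rpow_matrix y B /\<^sub>R y) (at y within S)"
    if "y > 0" for y S
    using bounded_linear.has_vector_derivative[OF lin has_vector_derivative_rpow_matrix[OF that, of B S]]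
    by (simp add: linear_cmul[OF linear_matrix_mult_left] matrix_mul_assoc matrix_inv_cancel[OF assms(1)])
  have "(LBINT y=ereal 1..ereal x. rpow_matrix y B /\<^sub>R y) = matrix_inv B ** rpow_matrix x B - matrix_inv B ** rpow_matrix 1 B"
  proof (rule interval_integral_FTC_finite)
    have "continuous_on {min 1 x..max 1 x} (\<lambda>y. rpow_matrix y B)"
      using assms(2) by (intro continuous_on_vector_derivative[OF has_vector_derivative_rpow_matrix]) auto
    then show "continuous_on {min 1 x..max 1 x} (\<lambda>y. rpow_matrix y B /\<^sub>R y)"
      using assms(2) by (intro continuous_intros) auto
  qed (use deriv assms(2) in auto)
  then show ?thesis by (simp add: rpow_matrix_one linear_diff[OF linear_matrix_mult_left])
qed

text \<open>Shows that h(x) g(t) is the increment of \<open>(c v* matrix_inv B) \<bullet> g\<close>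
  from \<open>t\<close> to \<open>x * t\<close>, once \<open>g (x * t)\<close> is replaced by its
  approximation \<open>rpow_matrix x B *v g t\<close>.\<close>

lemma inner_grv_h:
  assumes "invertible B" "x > 0"
  shows "grv_h B c x \<bullet> v = (c v* matrix_inv B) \<bullet> (rpow_matrix x B *v v) - (c v* matrix_inv B) \<bullet> v"
  by (simp add: grv_h_def interval_integral_rpow_matrix[OF assms] flip: vector_matrix_mul_assoc)
     (simp add: dot_lmul_matrix matrix_vector_mult_diff_rdistrib inner_diff_right)

section \<open>The last row of an upper triangular matrix\<close>

lemma upper_triangular_last_row:
  fixes B :: "real ^ 'n::{finite,linorder} ^ 'n::{finite,linorder}"
  assumes "\<And>i j. j < i \<Longrightarrow> B $ i $ j = 0" "j \<noteq> last_ix"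
  shows "B $ last_ix $ j = 0"
  using assms Max_ge[of UNIV j] by (simp add: order_le_less)

text \<open>Otherwise the whole last row of \<open>B\<close> would vanish, and with it the last row
  of \<open>B ** matrix_inv B = mat 1\<close>.\<close>

lemma upper_triangular_last_entry_nonzero:
  fixes B :: "real ^ 'n::{finite,linorder} ^ 'n::{finite,linorder}"
  assumes "\<And>i j. j < i \<Longrightarrow> B $ i $ j = 0" "invertible B"
  shows "B $ last_ix $ last_ix \<noteq> 0"
proof
  assume 0: "B $ last_ix $ last_ix = 0"
  have "B $ last_ix $ j = 0" for j
    using 0 upper_triangular_last_row[OF assms(1)] by (cases "j = last_ix") auto
  then have "(B ** matrix_inv B) $ last_ix $ last_ix = 0"
    by (simp add: matrix_matrix_mult_def)
  then show False using matrix_inv_cancel(1)[OF assms(2)] by (simp add: mat_def)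
qed

text \<open>The last row of every power of \<open>B\<close> is zero off the diagonal, so the last
  component of \<open>x^B v\<close> decouples from the others. This makes the last component of the
  rate vector a scalar regularly varying function.\<close>

lemma rpow_matrix_mult_last:
  fixes B :: "real ^ 'n::{finite,linorder} ^ 'n::{finite,linorder}"
  assumes upper: "\<And>i j. j < i \<Longrightarrow> B $ i $ j = 0" and "x > 0"
  shows "(rpow_matrix x B *v v) $ last_ix = x powr (B $ last_ix $ last_ix) * v $ last_ix"
proof -
  have pow: "matrix_pow A k $ last_ix $ j = (if j = last_ix then A $ last_ix $ last_ix ^ k else 0)"
    if "\<And>i j. j < i \<Longrightarrow> A $ i $ j = 0" for k j and A :: "real ^ 'n::{finite,linorder} ^ 'n::{finite,linorder}"
  proof (induction k)
    case (Suc k)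
    have "matrix_pow A (Suc k) $ last_ix $ j
        = (\<Sum>l\<in>(UNIV :: 'n set). if l = last_ix then A $ last_ix $ last_ix * matrix_pow A k $ last_ix $ j else 0)"
      unfolding matrix_pow.simps matrix_matrix_mult_def vec_lambda_beta
      by (rule sum.cong) (auto simp: upper_triangular_last_row[OF that])
    with Suc show ?case by simp
  qed (simp add: mat_def eq_commute)
  have "rpow_matrix x B $ last_ix $ j = (if j = last_ix then x powr (B $ last_ix $ last_ix) else 0)" for j
    using assms(2)
    by (simp add: rpow_matrix_def matrix_exp_nth pow upper powr_def exp_def divide_inverse_commute mult.commute[of "ln x"])
  then have "(rpow_matrix x B *v v) $ last_ix =
      (\<Sum>j\<in>(UNIV :: 'n set). if j = last_ix then x powr (B $ last_ix $ last_ix) * v $ last_ix else 0)"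
    unfolding matrix_vector_mult_def vec_lambda_beta by (intro sum.cong) auto
  then show ?thesis by simp
qed

section \<open>Uniform convergence from measurability\<close>

text \<open>Extension by 0 yields a function measurable on the whole line, whose dilations are then
  measurable for every \<open>t\<close>; values far to the left do not influence limits at
  infinity.\<close>

lemma measurable_near_infinity_globalE:
  fixes f :: "real \<Rightarrow> real"
  assumes "measurable_near_infinity f"
  obtains f' where "f' \<in> borel_measurable lebesgue" "\<forall>\<^sub>F t in at_top. f' t = f t"
proof -
  obtain t0 where "f \<in> borel_measurable (lebesgue_on {t0..})"
    using assms by (auto simp: measurable_near_infinity_def)
  then have "(\<lambda>t. if t \<in> {t0..} then f t else 0) \<in> borel_measurable lebesgue"
    by (rule borel_measurable_if_I) simp
  moreover have "\<forall>\<^sub>F t in at_top. (if t \<in> {t0..} then f t else 0) = f t"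
    using eventually_ge_at_top[of t0] by eventually_elim simp
  ultimately show ?thesis by (rule that)
qed

text \<open>For each fixed \<open>y\<close> the small-o relation expels \<open>y\<close> from the
  exceptional set once \<open>t\<close> is large. The indicators therefore tend to 0 pointwise, and
  dominated convergence on \<open>{1..4}\<close> carries this over to the measures.\<close>

lemma tendsto_measure_dilation_exceptional_set:
  fixes F w :: "real \<Rightarrow> real"
  assumes F: "F \<in> borel_measurable lebesgue"
    and o: "\<And>x. x > 0 \<Longrightarrow> (\<lambda>t. F (x * t) - F t) \<in> o[at_top](w)"
    and "\<delta> > 0"
  shows "((\<lambda>t. measure lebesgue {y \<in> {1..4}. \<delta> * \<bar>w t\<bar> < \<bar>F (y * t) - F t\<bar>}) \<longlongrightarrow> 0) at_top"
    (is "((\<lambda>t. measure _ (?A t)) \<longlongrightarrow> 0) at_top")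
    and "{y \<in> {1..4}. \<delta> * \<bar>w t\<bar> < \<bar>F (y * t) - F t\<bar>} \<in> lmeasurable"
proof -
  \<comment> \<open>Composition with a dilation preserves Lebesgue measurability, which composition
    with an arbitrary continuous map need not do.\<close>
  have meas: "(\<lambda>y. F (y * t)) \<in> borel_measurable lebesgue" for t
    using measurable_compose[OF lebesgue_measurable_scaling[of t] F] by (simp add: mult.commute)
  have A: "?A t \<in> lmeasurable" for t
  proof (rule fmeasurableI2[where A = "{1..4}"])
    have "{y \<in> space lebesgue. \<delta> * \<bar>w t\<bar> < \<bar>F (y * t) - F t\<bar>} \<in> sets lebesgue"
      using meas[of t] by measurable
    moreover have "?A t = {1..4} \<inter> {y \<in> space lebesgue. \<delta> * \<bar>w t\<bar> < \<bar>F (y * t) - F t\<bar>}"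
      by auto
    ultimately show "?A t \<in> sets lebesgue" by (simp only: sets.Int lmeasurable_interval fmeasurableD)
    show "?A t \<subseteq> {1..4}" by blast
  qed (rule lmeasurable_interval)
  then show "{y \<in> {1..4}. \<delta> * \<bar>w t\<bar> < \<bar>F (y * t) - F t\<bar>} \<in> lmeasurable" .
  have "((\<lambda>t. \<integral>y. indicat_real (?A t) y \<partial>lebesgue) \<longlongrightarrow> integral\<^sup>L lebesgue (\<lambda>y::real. 0)) at_top"
  proof (rule integral_dominated_convergence_at_top[where w = "indicator {1..4}"])
    show "indicat_real (?A t) \<in> borel_measurable lebesgue" for t
      by (rule borel_measurable_indicator[OF fmeasurableD[OF A]])
    show "AE y in lebesgue. ((\<lambda>t. indicat_real (?A t) y) \<longlongrightarrow> 0) at_top"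
    proof (rule AE_I2)
      fix y :: real
      show "((\<lambda>t. indicat_real (?A t) y) \<longlongrightarrow> 0) at_top"
      proof (cases "y \<in> {1..4}")
        case True
        then have "\<forall>\<^sub>F t in at_top. norm (F (y * t) - F t) \<le> \<delta> * norm (w t)"
          using landau_o.smallD[OF o \<open>\<delta> > 0\<close>, of y] by simp
        then have "\<forall>\<^sub>F t in at_top. indicat_real (?A t) y = 0"
          by eventually_elim (intro indicator_simps(2), simp)
        then show ?thesis by (rule tendsto_eventually)
      next
        case False
        then have "y \<notin> ?A t" for t by blast
        then have "indicat_real (?A t) y = 0" for t by (rule indicator_simps(2))
        then show ?thesis by (simp only: tendsto_const)
      qed
    qed
    show "integrable lebesgue (indicat_real {1..4::real})"
      using lmeasurable_cbox[of 1 "4::real"] by (simp add: lmeasurable_iff_integrable)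
    show "\<forall>\<^sub>F t in at_top. AE y in lebesgue. norm (indicat_real (?A t) y) \<le> indicat_real {1..4} y"
    proof (intro always_eventually allI AE_I2)
      fix t y :: real
      show "norm (indicat_real (?A t) y) \<le> indicat_real {1..4} y"
      proof (cases "y \<in> ?A t")
        case True
        then have "y \<in> {1..4}" by blast
        with True show ?thesis by (simp only: indicator_simps norm_one order_refl)
      next
        case False
        show ?thesis unfolding indicator_simps(2)[OF False] by (simp only: norm_zero indicator_pos_le)
      qed
    qed
  qed simp
  then show "((\<lambda>t. measure lebesgue (?A t)) \<longlongrightarrow> 0) at_top"
    by (simp only: Bochner_Integration.integral_indicator Bochner_Integration.integral_zero
        space_completion space_lborel space_borel Int_UNIV_right)
qed

lemma lmeasurable_real_scale:
  fixes c :: real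
  assumes "c > 0" and A: "A \<in> lmeasurable"
  shows "(*) c ` A \<in> lmeasurable" "measure lebesgue ((*) c ` A) = c * measure lebesgue A"
proof -
  have "(*) c ` cbox a b = cbox (c * a) (c * b)" if "a \<le> b" for a b
    using \<open>c > 0\<close> that image_mult_atLeastAtMost[of c a b] by simp
  then have "measure lebesgue ((*) c ` cbox a b) = c * measure lebesgue (cbox a b)" for a b
    using \<open>c > 0\<close> by (cases "a \<le> b") (auto simp: right_diff_distrib)
  from measure_linear_sufficient[OF linear_times A this]
  show "(*) c ` A \<in> lmeasurable" "measure lebesgue ((*) c ` A) = c * measure lebesgue A" by auto
qed

text \<open>A uniform convergence theorem with increments measured against a weight
  \<open>w\<close>. The bound on \<open>w (l * t)\<close> allows errors at base point
  \<open>l * t\<close> to be charged to \<open>w t\<close>. It is applied with \<open>w\<close>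
  constant to the logarithm of \<open>G\<close>, and then with \<open>w = G\<close> to
  \<phi>.\<close>

lemma uniform_dilation_bound:
  fixes F w :: "real \<Rightarrow> real"
  assumes F: "measurable_near_infinity F"
    and o: "\<And>x. x > 0 \<Longrightarrow> (\<lambda>t. F (x * t) - F t) \<in> o[at_top](w)"
    and w: "\<forall>\<^sub>F t in at_top. \<forall>l\<in>{1..2}. \<bar>w (l * t)\<bar> \<le> K * \<bar>w t\<bar>"
    and "\<epsilon> > 0"
  shows "\<forall>\<^sub>F t in at_top. \<forall>l\<in>{1..2}. \<bar>F (l * t) - F t\<bar> \<le> \<epsilon> * \<bar>w t\<bar>"
proof -
  obtain F' where F': "F' \<in> borel_measurable lebesgue" and eq: "\<forall>\<^sub>F t in at_top. F' t = F t"
    using measurable_near_infinity_globalE[OF F] .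
  define K' where "K' = max K 0"
  have K': "K' \<ge> 0" "K \<le> K'" by (auto simp: K'_def)
  \<comment> \<open>The final estimate adds an error \<open>\<delta> * \<bar>w t\<bar>\<close> and
    an error of at most \<open>\<delta> * K' * \<bar>w t\<bar>\<close>; this \<delta> makes the
    total \<epsilon>.\<close>
  define \<delta> where "\<delta> = \<epsilon> / (1 + K')"
  have \<delta>: "\<delta> > 0" "\<delta> * (1 + K') = \<epsilon>" using \<open>\<epsilon> > 0\<close> K' by (auto simp: \<delta>_def)
  have o': "(\<lambda>t. F' (x * t) - F' t) \<in> o[at_top](w)" if "x > 0" for x
  proof (rule landau_o.small.in_cong[THEN iffD2, OF _ o[OF that]])
    have "\<forall>\<^sub>F t in at_top. F' (x * t) = F (x * t)"
      using eventually_compose_filterlim[OF eq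
          filterlim_at_top_mult_tendsto_pos[OF tendsto_const that filterlim_ident]]
      by (simp add: mult.commute)
    with eq show "\<forall>\<^sub>F t in at_top. F' (x * t) - F' t = F (x * t) - F t"
      by eventually_elim simp
  qed
  \<comment> \<open>The range \<open>{1..4}\<close> contains both \<open>z\<close> and
    \<open>z / l\<close> whenever \<open>z\<close> is in \<open>{2..4}\<close> and \<open>l\<close>
    in \<open>{1..2}\<close>.\<close>
  define A where "A t = {y \<in> {1..4}. \<delta> * \<bar>w t\<bar> < \<bar>F' (y * t) - F' t\<bar>}" for t
  have A: "A t \<in> lmeasurable" for t
    unfolding A_def by (rule tendsto_measure_dilation_exceptional_set(2)[OF F' o' \<delta>(1)])
  have "((\<lambda>t. measure lebesgue (A t)) \<longlongrightarrow> 0) at_top"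
    unfolding A_def by (rule tendsto_measure_dilation_exceptional_set(1)[OF F' o' \<delta>(1)])
  \<comment> \<open>With 1/2, the two exceptional sets, one of them stretched by at most 2, have
    total measure below 3/2, less than the length 2 of \<open>{2..4}\<close>.\<close>
  then have "\<forall>\<^sub>F t in at_top. measure lebesgue (A t) < 1/2"
    by (rule order_tendstoD) simp
  from eventually_conj[OF this eventually_conj[OF eq w]] obtain T where "\<And>t. t \<ge> T \<Longrightarrow>
      measure lebesgue (A t) < 1/2 \<and> F' t = F t \<and> (\<forall>l\<in>{1..2}. \<bar>w (l * t)\<bar> \<le> K * \<bar>w t\<bar>)"
    unfolding eventually_at_top_linorder by auto
  then have T: "\<And>t. t \<ge> T \<Longrightarrow> measure lebesgue (A t) < 1/2"
      "\<And>t. t \<ge> T \<Longrightarrow> F' t = F t" "\<And>t l. t \<ge> T \<Longrightarrow> l \<in> {1..2} \<Longrightarrow> \<bar>w (l * t)\<bar> \<le> K * \<bar>w t\<bar>"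
    by auto
  have "\<forall>l\<in>{1..2}. \<bar>F (l * t) - F t\<bar> \<le> \<epsilon> * \<bar>w t\<bar>" if t: "t \<ge> max T 0" for t
  proof
    fix l :: real assume l: "l \<in> {1..2}"
    have lt: "l * t \<ge> T" using l t mult_right_mono[of 1 l t] by auto
    have "l > 0" using l by simp
    txt \<open>The exceptional sets at \<open>t\<close> and at \<open>l * t\<close>, the latter rescaled, are too small to
      cover \<open>{2..4}\<close>; a point \<open>z\<close> outside both links \<open>F (l * t)\<close> and \<open>F t\<close> through \<open>F (z * t)\<close>.\<close>
    note scaled = lmeasurable_real_scale[OF this A[of "l * t"]]
    have "measure lebesgue (A t \<union> (*) l ` A (l * t)) \<le> measure lebesgue (A t) + l * measure lebesgue (A (l * t))"
      using measure_Un_le[OF fmeasurableD[OF A] fmeasurableD[OF scaled(1)], of t] unfolding scaled(2) .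
    also have "\<dots> < 1/2 + 2 * (1/2)"
      using T(1)[of t] T(1)[OF lt] t l by (intro add_strict_mono mult_le_less_imp_less) auto
    finally have "measure lebesgue (A t \<union> (*) l ` A (l * t)) < measure lebesgue {2..4::real}"
      by simp
    moreover have "A t \<union> (*) l ` A (l * t) \<in> lmeasurable"
      by (rule fmeasurable.Un[OF A scaled(1)])
    ultimately have "\<not> {2..4} \<subseteq> A t \<union> (*) l ` A (l * t)"
      using measure_mono_fmeasurable[of "{2..4::real}" "A t \<union> (*) l ` A (l * t)" lebesgue]
        fmeasurableD[OF lmeasurable_interval(1)] linorder_not_le by blast
    then obtain z where z: "z \<in> {2..4}" "z \<notin> A t" "z \<notin> (*) l ` A (l * t)" by blast
    then have "z / l \<notin> A (l * t)" using l by (force simp: image_iff)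
    moreover have "z / l \<in> {1..4}" using z(1) l by (auto simp: field_simps)
    ultimately have "\<bar>F' (z * t) - F' (l * t)\<bar> \<le> \<delta> * \<bar>w (l * t)\<bar>"
      using l by (auto simp: A_def not_less)
    moreover have "\<bar>w (l * t)\<bar> \<le> K' * \<bar>w t\<bar>"
      using T(3)[of t l] t l mult_right_mono[OF K'(2), of "\<bar>w t\<bar>"] by simp
    then have "\<delta> * \<bar>w (l * t)\<bar> \<le> \<delta> * (K' * \<bar>w t\<bar>)"
      using \<delta>(1) by (intro mult_left_mono) auto
    ultimately have "\<bar>F' (l * t) - F' t\<bar> \<le> \<delta> * (K' * \<bar>w t\<bar>) + \<delta> * \<bar>w t\<bar>"
      using z(1,2) by (auto simp: A_def not_less)
    also have "\<dots> = \<epsilon> * \<bar>w t\<bar>" using \<delta>(2)[symmetric] by (simp add: algebra_simps)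
    finally show "\<bar>F (l * t) - F t\<bar> \<le> \<epsilon> * \<bar>w t\<bar>" using T(2) lt t by simp
  qed
  then show ?thesis unfolding eventually_at_top_linorder by (intro exI[of _ "max T 0"]) blast
qed

section \<open>Dyadic sequences and auxiliary limits\<close>

text \<open>Telescoping: the increments are dominated by a geometric series, whose sum also bounds
  the distance from \<open>a 0\<close> to the limit.\<close>

lemma tendsto_if_geometric_increments:
  fixes a :: "nat \<Rightarrow> real"
  assumes d: "\<And>k. \<bar>a (Suc k) - a k\<bar> \<le> D * q ^ k" and q: "0 \<le> q" "q < 1"
  obtains l where "a \<longlonglongrightarrow> l" "\<bar>a 0 - l\<bar> \<le> D / (1 - q)"
proof -
  have geo: "(\<lambda>k. D * q ^ k) sums (D / (1 - q))"
    using sums_mult[OF geometric_sums[of q], of D] q by simp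
  have summ: "summable (\<lambda>k. \<bar>a (Suc k) - a k\<bar>)"
    by (rule summable_comparison_test'[OF sums_summable[OF geo], of 0]) (simp only: real_norm_def abs_abs d)
  define l where "l = a 0 + (\<Sum>k. a (Suc k) - a k)"
  have "(\<lambda>n. a 0 + (\<Sum>k<n. a (Suc k) - a k)) \<longlonglongrightarrow> l"
    unfolding l_def by (rule tendsto_add[OF tendsto_const summable_LIMSEQ[OF summable_rabs_cancel[OF summ]]])
  moreover have "a 0 + (\<Sum>k<n. a (Suc k) - a k) = a n" for n
    using sum_lessThan_telescope[of a n] by linarith
  ultimately have "a \<longlonglongrightarrow> l" by simp
  moreover have "\<bar>\<Sum>k. a (Suc k) - a k\<bar> \<le> D / (1 - q)"
    using summable_rabs[OF summ] suminf_le[OF d summ sums_summable[OF geo]] sums_unique[OF geo] by linarith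
  then have "\<bar>a 0 - l\<bar> \<le> D / (1 - q)" by (simp add: l_def)
  ultimately show ?thesis by (rule that)
qed

text \<open>Reduces any \<open>s\<close> beyond \<open>T\<close> to a starting point in
  \<open>{T..2 * T}\<close> followed by \<open>k\<close> doublings.\<close>

lemma obtain_dyadic_scale:
  fixes s T :: real
  assumes "0 < T" "T \<le> s"
  obtains k l where "l \<in> {1..2}" "s = 2 ^ k * (l * T)"
proof -
  define r where "r = s / T"
  have r: "1 \<le> r" "s = r * T" using assms by (simp_all add: r_def)
  obtain n0 where "r < 2 ^ n0" using real_arch_pow[of 2 r] by auto
  then have least: "r < 2 ^ (LEAST n. r < 2 ^ n)" by (rule LeastI)
  \<comment> \<open>The least exponent with \<open>r < 2 ^ n\<close> is positive because
    \<open>r\<close> is at least 1; its predecessor \<open>k\<close> satisfies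
    \<open>2 ^ k \<le> r < 2 ^ Suc k\<close>.\<close>
  have "(LEAST n. r < 2 ^ n) \<noteq> 0" using least r(1) by (intro notI) simp
  then obtain k where k: "(LEAST n. r < 2 ^ n) = Suc k" using not0_implies_Suc by blast
  then have "\<not> r < 2 ^ k" by (intro not_less_Least) simp
  define l where "l = r / 2 ^ k"
  have l: "r = 2 ^ k * l" by (simp add: l_def)
  have "2 ^ k * 1 \<le> 2 ^ k * l" "2 ^ k * l \<le> 2 ^ k * 2"
    using \<open>\<not> r < 2 ^ k\<close> least[unfolded k] unfolding l[symmetric] by simp_all
  then have "l \<in> {1..2}" by simp
  moreover have "s = 2 ^ k * (l * T)" by (simp only: r(2) l mult.assoc)
  ultimately show ?thesis by (rule that)
qed

lemma filterlim_dilation: "x > 0 \<Longrightarrow> filterlim (\<lambda>t::real. x * t) at_top at_top"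
  by (rule filterlim_tendsto_pos_mult_at_top[OF tendsto_const _ filterlim_ident])

lemma filterlim_powr_at_top:
  fixes p :: real
  assumes "p > 0"
  shows "filterlim (\<lambda>x::real. x powr p) at_top at_top"
  unfolding filterlim_at_top_gt[of _ _ "0::real"]
proof (intro allI impI)
  fix Z :: real assume "Z > 0"
  show "\<forall>\<^sub>F x in at_top. Z \<le> x powr p"
    using eventually_ge_at_top[of "Z powr (1 / p)"]
  proof eventually_elim
    case (elim x)
    then have "(Z powr (1 / p)) powr p \<le> x powr p" using assms by (intro powr_mono2) auto
    then show ?case using assms \<open>Z > 0\<close> by (simp add: powr_powr)
  qed
qed

lemma measurable_near_infinity_ln_abs_diff:
  fixes G :: "real \<Rightarrow> real"
  assumes "measurable_near_infinity G"
  shows "measurable_near_infinity (\<lambda>t. ln \<bar>G t\<bar> - b * ln t)"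
proof -
  obtain t0 where [measurable]: "G \<in> borel_measurable (lebesgue_on {t0..})"
    using assms by (auto simp: measurable_near_infinity_def)
  have [measurable]: "(\<lambda>t. t) \<in> borel_measurable (lebesgue_on {t0..})"
    by (intro measurable_restrict_space1 measurable_completion) simp
  have "(\<lambda>t. ln \<bar>G t\<bar> - b * ln t) \<in> borel_measurable (lebesgue_on {t0..})"
    by measurable
  then show ?thesis unfolding measurable_near_infinity_def by (rule exI)
qed

section \<open>Increments against a scalar regularly varying function\<close>

text \<open>Models the last component of the rate vector, with \<open>b\<close> the last diagonal
  entry of \<open>B\<close>.\<close>

locale regularly_varying_scalar =
  fixes G :: "real \<Rightarrow> real" and b :: real
  assumes nonzero: "\<forall>\<^sub>F t in at_top. G t \<noteq> 0"
    and dilation: "\<And>x. x > 0 \<Longrightarrow> (\<lambda>t. G (x * t) - x powr b * G t) \<in> o[at_top](G)"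
begin

lemma ratio_tendsto:
  assumes "x > 0"
  shows "((\<lambda>t. \<bar>G (x * t)\<bar> / \<bar>G t\<bar>) \<longlongrightarrow> x powr b) at_top"
proof -
  have "((\<lambda>t. (G (x * t) - x powr b * G t) / G t + x powr b) \<longlongrightarrow> 0 + x powr b) at_top"
    using dilation[OF assms] by (intro tendsto_add smalloD_tendsto tendsto_const)
  moreover have "\<forall>\<^sub>F t in at_top. (G (x * t) - x powr b * G t) / G t + x powr b = G (x * t) / G t"
    using nonzero by eventually_elim (simp add: field_simps)
  ultimately have "((\<lambda>t. G (x * t) / G t) \<longlongrightarrow> 0 + x powr b) at_top"
    by (rule Lim_transform_eventually)
  from tendsto_rabs[OF this] show ?thesis by (simp add: abs_divide)
qed

text \<open>The ratio \<open>G (x * t) / G t\<close> stays bounded, so an error relative to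
  \<open>G (x * t)\<close> is also one relative to \<open>G t\<close>.\<close>

lemma smallo_dilation:
  assumes "r \<in> o[at_top](G)" "x > 0"
  shows "(\<lambda>t. r (x * t)) \<in> o[at_top](G)"
proof -
  have "(\<lambda>t. r (x * t)) \<in> o[at_top](\<lambda>t. G (x * t))"
    by (rule landau_o.small.compose[OF assms(1) filterlim_dilation[OF assms(2)]])
  also have "(\<lambda>t. G (x * t)) \<in> O[at_top](G)"
    using bigoI_tendsto[OF ratio_tendsto[OF assms(2)]] nonzero by simp
  finally show ?thesis .
qed

text \<open>The converse direction of the equivalence: \<open>C\<close> cancels in the
  increment.\<close>

lemma increment_smallo_if_asymptotically_constant:
  assumes "(\<lambda>t. \<phi> t - C) \<in> o[at_top](G)" "x > 0"
  shows "(\<lambda>t. \<phi> (x * t) - \<phi> t) \<in> o[at_top](G)"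
  using sum_in_smallo(2)[OF smallo_dilation[OF assms] assms(1)] by simp

text \<open>Follows \<phi> outward along \<open>2 ^ k * t\<close>, where \<open>G\<close> decays
  geometrically. Only the increments for the factors 2 and \<open>t / t1\<close> enter, so pointwise
  information suffices.\<close>

lemma asymptotically_constant_neg:
  assumes b: "b < 0" and \<phi>: "\<And>x. x > 0 \<Longrightarrow> (\<lambda>t. \<phi> (x * t) - \<phi> t) \<in> o[at_top](G)"
  shows "\<exists>C. (\<lambda>t. \<phi> t - C) \<in> o[at_top](G)"
proof -
  \<comment> \<open>A number strictly between \<open>2 powr b\<close> and 1; the slack absorbs the
    error in \<open>G (2 * t) / G t\<close>.\<close>
  define q where "q = 2 powr (b / 2)"
  have q: "0 \<le> q" "q < 1" "2 powr b < q"
    using b powr_less_cancel_iff[of 2 "b / 2" 0] by (auto simp: q_def)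
  have "\<forall>\<^sub>F t in at_top. \<bar>G (2 * t)\<bar> \<le> q * \<bar>G t\<bar>"
    using order_tendstoD(2)[OF ratio_tendsto[of 2] q(3), simplified] nonzero
    by eventually_elim (simp add: field_simps)
  from eventually_conj[OF this eventually_gt_at_top[of 0]]
  obtain T where T: "T > 0" "\<And>t. t \<ge> T \<Longrightarrow> \<bar>G (2 * t)\<bar> \<le> q * \<bar>G t\<bar>"
    unfolding eventually_at_top_linorder by auto
  have ge: "2 ^ k * t \<ge> t" if "t \<ge> T" for k and t :: real
    using that T(1) mult_right_mono[of 1 "2 ^ k" t] by simp
  have decay: "\<bar>G (2 ^ k * t)\<bar> \<le> q ^ k * \<bar>G t\<bar>" if t: "t \<ge> T" for k t
  proof (induction k)
    case (Suc k)
    have "\<bar>G (2 * (2 ^ k * t))\<bar> \<le> q * \<bar>G (2 ^ k * t)\<bar>"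
      using ge[OF t, of k] t by (intro T(2)) simp
    also have "\<dots> \<le> q * (q ^ k * \<bar>G t\<bar>)" using Suc q(1) by (rule mult_left_mono)
    finally show ?case by (simp add: mult_ac)
  qed simp
  have limit: "\<forall>\<^sub>F t in at_top. t \<ge> T \<and> (\<exists>l. (\<lambda>k. \<phi> (2 ^ k * t)) \<longlonglongrightarrow> l \<and> \<bar>\<phi> t - l\<bar> \<le> \<epsilon> * \<bar>G t\<bar>)"
    if "\<epsilon> > 0" for \<epsilon>
  proof -
    \<comment> \<open>The factor \<open>1 - q\<close> makes the geometric series of the increments
      sum to \<open>\<epsilon> * \<bar>G t\<bar>\<close>.\<close>
    have "\<epsilon> * (1 - q) > 0" using that q by simp
    then have "\<forall>\<^sub>F t in at_top. \<bar>\<phi> (2 * t) - \<phi> t\<bar> \<le> \<epsilon> * (1 - q) * \<bar>G t\<bar>"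
      using landau_o.smallD[OF \<phi>, of 2] by simp
    then obtain S where S: "\<And>t. t \<ge> S \<Longrightarrow> \<bar>\<phi> (2 * t) - \<phi> t\<bar> \<le> \<epsilon> * (1 - q) * \<bar>G t\<bar>"
      by (auto simp: eventually_at_top_linorder)
    have "\<exists>l. (\<lambda>k. \<phi> (2 ^ k * t)) \<longlonglongrightarrow> l \<and> \<bar>\<phi> t - l\<bar> \<le> \<epsilon> * \<bar>G t\<bar>" if t: "t \<ge> max S T" for t
    proof -
      have "\<bar>\<phi> (2 ^ Suc k * t) - \<phi> (2 ^ k * t)\<bar> \<le> \<epsilon> * (1 - q) * \<bar>G t\<bar> * q ^ k" for k
      proof -
        have "\<bar>\<phi> (2 * (2 ^ k * t)) - \<phi> (2 ^ k * t)\<bar> \<le> \<epsilon> * (1 - q) * \<bar>G (2 ^ k * t)\<bar>"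
          using ge[of t k] t by (intro S) simp
        also have "\<dots> \<le> \<epsilon> * (1 - q) * (q ^ k * \<bar>G t\<bar>)"
          using decay[of t k] t \<open>\<epsilon> * (1 - q) > 0\<close> by (intro mult_left_mono) auto
        finally show ?thesis by (simp add: mult_ac)
      qed
      from tendsto_if_geometric_increments[OF this q(1,2)] obtain l
        where "(\<lambda>k. \<phi> (2 ^ k * t)) \<longlonglongrightarrow> l" "\<bar>\<phi> (2 ^ 0 * t) - l\<bar> \<le> \<epsilon> * (1 - q) * \<bar>G t\<bar> / (1 - q)"
        by blast
      then show ?thesis using q by auto
    qed
    then show ?thesis
      unfolding eventually_at_top_linorder by (intro exI[of _ "max S T"]) auto
  qed
  \<comment> \<open>The tolerance 1 is arbitrary: one convergent doubling sequence is wanted, and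
    its limit is the candidate for \<open>C\<close>.\<close>
  obtain t1 where t1: "t1 \<ge> T" and "\<exists>l. (\<lambda>k. \<phi> (2 ^ k * t1)) \<longlonglongrightarrow> l"
    using eventually_happens[OF limit[of 1]] by auto
  then obtain C where C: "(\<lambda>k. \<phi> (2 ^ k * t1)) \<longlonglongrightarrow> C" by blast
  have dyadic: "filterlim (\<lambda>k. 2 ^ k * t1) at_top sequentially"
    using t1 T(1)
    by (intro filterlim_at_top_mult_tendsto_pos[OF tendsto_const]
        filterlim_at_infinity_imp_filterlim_at_top[OF filterlim_realpow_sequentially_gt1]) auto
  \<comment> \<open>The increment for the fixed factor \<open>t / t1\<close>, taken along
    \<open>2 ^ k * t1\<close>, compares the two doubling sequences; it is small relative to
    \<open>G (2 ^ k * t1)\<close>, which itself tends to 0.\<close>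
  have const: "l = C" if "t \<ge> T" "(\<lambda>k. \<phi> (2 ^ k * t)) \<longlonglongrightarrow> l" for t l
  proof -
    have "t / t1 > 0" using that(1) t1 T(1) by simp
    have "(\<lambda>k. q ^ k * \<bar>G t1\<bar>) \<longlonglongrightarrow> 0"
      using tendsto_mult_left_zero[OF LIMSEQ_realpow_zero[OF q(1,2)]] .
    then have "(\<lambda>k. G (2 ^ k * t1)) \<longlonglongrightarrow> 0"
      by (rule Lim_null_comparison[rotated]) (use decay[OF t1] in auto)
    moreover have "(\<lambda>k. \<phi> (t / t1 * (2 ^ k * t1)) - \<phi> (2 ^ k * t1)) \<in> o(\<lambda>k. G (2 ^ k * t1))"
      by (rule landau_o.small.compose[OF \<phi>[OF \<open>t / t1 > 0\<close>] dyadic])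
    from landau_o.smallD[OF this, of 1]
    have "\<forall>\<^sub>F k in sequentially.
        norm (\<phi> (t / t1 * (2 ^ k * t1)) - \<phi> (2 ^ k * t1)) \<le> \<bar>G (2 ^ k * t1)\<bar>"
      by simp
    ultimately have "(\<lambda>k. \<phi> (t / t1 * (2 ^ k * t1)) - \<phi> (2 ^ k * t1)) \<longlonglongrightarrow> 0"
      by - (rule Lim_null_comparison[OF _ tendsto_rabs_zero])
    moreover have "t / t1 * (2 ^ k * t1) = 2 ^ k * t" for k using t1 T(1) by simp
    ultimately have "(\<lambda>k. \<phi> (2 ^ k * t) - \<phi> (2 ^ k * t1)) \<longlonglongrightarrow> 0" by simp
    from LIMSEQ_unique[OF this tendsto_diff[OF that(2) C]] show ?thesis by simp
  qed
  have "(\<lambda>t. \<phi> t - C) \<in> o[at_top](G)"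
  proof (rule landau_o.smallI)
    fix \<epsilon> :: real assume "\<epsilon> > 0"
    from limit[OF this] show "\<forall>\<^sub>F t in at_top. norm (\<phi> t - C) \<le> \<epsilon> * norm (G t)"
      by eventually_elim (use const in auto)
  qed
  then show ?thesis ..
qed

text \<open>Uniform convergence for \<open>ln \<bar>G t\<bar> - b * ln t\<close> with tolerance 1,
  exponentiated. The upper bound qualifies \<open>G\<close> as a weight for \<phi>; the lower bound
  controls \<open>G\<close> between dyadic points.\<close>

lemma locally_uniform_bounds:
  assumes b: "b > 0" and G: "measurable_near_infinity G"
  shows "\<forall>\<^sub>F t in at_top. \<forall>l\<in>{1..2}. \<bar>G (l * t)\<bar> \<le> exp 1 * 2 powr b * \<bar>G t\<bar> \<and> \<bar>G t\<bar> \<le> exp 1 * \<bar>G (l * t)\<bar>"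
proof -
  define H where "H t = ln \<bar>G t\<bar> - b * ln t" for t
  have ev: "\<forall>\<^sub>F t in at_top. t > 0 \<and> G t \<noteq> 0"
    using nonzero eventually_gt_at_top[of 0] by eventually_elim simp
  have "(\<lambda>t. H (x * t) - H t) \<in> o[at_top](\<lambda>_. 1)" if x: "x > 0" for x
  proof (rule smalloI_tendsto)
    have "((\<lambda>t. ln (\<bar>G (x * t)\<bar> / \<bar>G t\<bar>) - b * ln x) \<longlongrightarrow> ln (x powr b) - b * ln x) at_top"
      using x by (intro tendsto_diff tendsto_ln ratio_tendsto tendsto_const) auto
    then have "((\<lambda>t. ln (\<bar>G (x * t)\<bar> / \<bar>G t\<bar>) - b * ln x) \<longlongrightarrow> 0) at_top"
      using x by simp
    moreover have "\<forall>\<^sub>F t in at_top. ln (\<bar>G (x * t)\<bar> / \<bar>G t\<bar>) - b * ln x = (H (x * t) - H t) / 1"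
      using ev eventually_compose_filterlim[OF ev filterlim_dilation[OF x]]
      by eventually_elim (use x in \<open>simp add: H_def ln_div ln_mult algebra_simps\<close>)
    ultimately show "((\<lambda>t. (H (x * t) - H t) / 1) \<longlongrightarrow> 0) at_top"
      by (rule Lim_transform_eventually)
  qed simp
  then have "\<forall>\<^sub>F t in at_top. \<forall>l\<in>{1..2}. \<bar>H (l * t) - H t\<bar> \<le> 1 * \<bar>1\<bar>"
    using measurable_near_infinity_ln_abs_diff[OF G, of b] unfolding H_def
    by (intro uniform_dilation_bound[where K = 1 and w = "\<lambda>_. 1"]) simp_all
  \<comment> \<open>Nonvanishing is required at \<open>l * t\<close> for every \<open>l\<close> in
    \<open>{1..2}\<close> simultaneously, hence at all \<open>s\<close> beyond
    \<open>t\<close>.\<close>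
  moreover have "\<forall>\<^sub>F t in at_top. \<forall>s\<ge>t. s > 0 \<and> G s \<noteq> 0"
    using ev by (rule eventually_all_ge_at_top)
  ultimately show ?thesis
  proof eventually_elim
    case (elim t)
    show ?case
    proof
      fix l :: real assume l: "l \<in> {1..2}"
      have t: "t > 0" "G t \<noteq> 0" using elim(2) by auto
      have "l * t \<ge> t" using l t mult_right_mono[of 1 l t] by simp
      then have Gl: "G (l * t) \<noteq> 0" using elim(2) by blast
      \<comment> \<open>Since \<open>b\<close> is positive, this term costs a factor
        \<open>2 powr b\<close> in the upper bound and nothing in the lower one.\<close>
      have lnl: "0 \<le> b * ln l" "b * ln l \<le> b * ln 2" using b l by auto
      have H_eq: "H (l * t) = ln \<bar>G (l * t)\<bar> - b * ln l - b * ln t"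
        using l t by (simp add: H_def ln_mult distrib_left)
      have "\<bar>H (l * t) - H t\<bar> \<le> 1" using elim(1) l by simp
      then have "ln \<bar>G (l * t)\<bar> \<le> 1 + b * ln 2 + ln \<bar>G t\<bar>" "ln \<bar>G t\<bar> \<le> 1 + ln \<bar>G (l * t)\<bar>"
        using lnl unfolding H_eq unfolding H_def by linarith+
      then have "exp (ln \<bar>G (l * t)\<bar>) \<le> exp (1 + b * ln 2 + ln \<bar>G t\<bar>)" "exp (ln \<bar>G t\<bar>) \<le> exp (1 + ln \<bar>G (l * t)\<bar>)"
        by simp_all
      then show "\<bar>G (l * t)\<bar> \<le> exp 1 * 2 powr b * \<bar>G t\<bar> \<and> \<bar>G t\<bar> \<le> exp 1 * \<bar>G (l * t)\<bar>"
        using t(2) Gl unfolding exp_add powr_def by simp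
    qed
  qed
qed

text \<open>As \<open>G\<close> grows geometrically under doubling, the accumulated increments are
  comparable to the last one. What remains is a constant \<open>D\<close> from
  \<open>{T..2 * T}\<close>, which the growth of \<open>G\<close> absorbs; the uniform bounds are
  what makes \<open>D\<close> common to all starting points.\<close>

lemma asymptotically_zero_pos:
  assumes b: "b > 0" and G: "measurable_near_infinity G" and m: "measurable_near_infinity \<phi>"
    and \<phi>: "\<And>x. x > 0 \<Longrightarrow> (\<lambda>t. \<phi> (x * t) - \<phi> t) \<in> o[at_top](G)"
  shows "\<phi> \<in> o[at_top](G)"
proof (rule landau_o.smallI)
  fix \<epsilon> :: real assume \<epsilon>: "\<epsilon> > 0"
  \<comment> \<open>Between 1 and \<open>2 powr b\<close>, and chosen so that \<open>q ^ k\<close>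
    is the power \<open>b / 2\<close> of \<open>2 ^ k\<close>, which is later compared with a power
    of \<open>s\<close>.\<close>
  define q where "q = 2 powr (b / 2)"
  have q: "1 < q" "q < 2 powr b"
    using b powr_less_cancel_iff[of 2 0 "b / 2"] by (auto simp: q_def)
  \<comment> \<open>Chosen so that \<open>\<epsilon> / 2 + \<delta> = \<epsilon> / 2 * q\<close>:
    the growth of \<open>G\<close> in one doubling pays for the new increment. The other half of
    \<epsilon> is kept for \<open>D\<close>.\<close>
  define \<delta> where "\<delta> = \<epsilon> / 2 * (q - 1)"
  have \<delta>: "\<delta> > 0" using \<epsilon> q by (simp add: \<delta>_def)
  have growth: "\<forall>\<^sub>F t in at_top. q * \<bar>G t\<bar> \<le> \<bar>G (2 * t)\<bar>"
    using order_tendstoD(1)[OF ratio_tendsto[of 2] q(2), simplified] nonzero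
    by eventually_elim (simp add: field_simps)
  have bounds: "\<forall>\<^sub>F t in at_top. \<forall>l\<in>{1..2}. \<bar>G (l * t)\<bar> \<le> exp 1 * 2 powr b * \<bar>G t\<bar> \<and> \<bar>G t\<bar> \<le> exp 1 * \<bar>G (l * t)\<bar>"
    by (rule locally_uniform_bounds[OF b G])
  then have "\<forall>\<^sub>F t in at_top. \<forall>l\<in>{1..2}. \<bar>G (l * t)\<bar> \<le> exp 1 * 2 powr b * \<bar>G t\<bar>"
    by eventually_elim blast
  then have "\<forall>\<^sub>F t in at_top. \<forall>l\<in>{1..2}. \<bar>\<phi> (l * t) - \<phi> t\<bar> \<le> \<delta> * \<bar>G t\<bar>"
    by - (rule uniform_dilation_bound[OF m \<phi> _ \<delta>])
  with growth bounds nonzero eventually_gt_at_top[of 0]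
  have "\<forall>\<^sub>F t in at_top. t > 0 \<and> G t \<noteq> 0 \<and> q * \<bar>G t\<bar> \<le> \<bar>G (2 * t)\<bar> \<and>
      (\<forall>l\<in>{1..2}. \<bar>\<phi> (l * t) - \<phi> t\<bar> \<le> \<delta> * \<bar>G t\<bar> \<and> \<bar>G t\<bar> \<le> exp 1 * \<bar>G (l * t)\<bar>)"
    by eventually_elim auto
  then obtain T where T: "\<And>t. t \<ge> T \<Longrightarrow> t > 0 \<and> G t \<noteq> 0 \<and> q * \<bar>G t\<bar> \<le> \<bar>G (2 * t)\<bar> \<and>
      (\<forall>l\<in>{1..2}. \<bar>\<phi> (l * t) - \<phi> t\<bar> \<le> \<delta> * \<bar>G t\<bar> \<and> \<bar>G t\<bar> \<le> exp 1 * \<bar>G (l * t)\<bar>)"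
    unfolding eventually_at_top_linorder by auto
  have T0: "T > 0" "G T \<noteq> 0" using T[of T] by auto
  \<comment> \<open>Bounds \<phi> in absolute value on all of \<open>{T..2 * T}\<close>.\<close>
  define D where "D = \<bar>\<phi> T\<bar> + \<delta> * \<bar>G T\<bar>"
  have ge: "2 ^ k * t \<ge> T" if "t \<ge> T" for k and t :: real
  proof -
    have "1 * t \<le> 2 ^ k * t" using that T0 by (intro mult_right_mono) auto
    with that show ?thesis by simp
  qed
  have step: "\<bar>\<phi> (2 ^ k * t)\<bar> \<le> \<bar>\<phi> t\<bar> + \<epsilon> / 2 * \<bar>G (2 ^ k * t)\<bar> \<and> q ^ k * \<bar>G t\<bar> \<le> \<bar>G (2 ^ k * t)\<bar>"
    if t: "t \<ge> T" for k t
  proof (induction k)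
    case (Suc k)
    define s where "s = 2 ^ k * t"
    have IH: "\<bar>\<phi> s\<bar> \<le> \<bar>\<phi> t\<bar> + \<epsilon> / 2 * \<bar>G s\<bar>" "q ^ k * \<bar>G t\<bar> \<le> \<bar>G s\<bar>"
      using Suc unfolding s_def by blast+
    have "s \<ge> T" using ge[OF t, of k] by (simp only: s_def)
    note Ts = T[OF this]
    then have G2: "q * \<bar>G s\<bar> \<le> \<bar>G (2 * s)\<bar>" by blast
    have "(2::real) \<in> {1..2}" by simp
    with Ts have "\<bar>\<phi> (2 * s) - \<phi> s\<bar> \<le> \<delta> * \<bar>G s\<bar>" by blast
    with IH(1) have "\<bar>\<phi> (2 * s)\<bar> \<le> \<bar>\<phi> t\<bar> + \<epsilon> / 2 * \<bar>G s\<bar> + \<delta> * \<bar>G s\<bar>"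
      by linarith
    also have "\<dots> = \<bar>\<phi> t\<bar> + \<epsilon> / 2 * (q * \<bar>G s\<bar>)" by (simp add: \<delta>_def field_simps)
    also have "\<dots> \<le> \<bar>\<phi> t\<bar> + \<epsilon> / 2 * \<bar>G (2 * s)\<bar>" using G2 \<epsilon> by simp
    finally have "\<bar>\<phi> (2 * s)\<bar> \<le> \<bar>\<phi> t\<bar> + \<epsilon> / 2 * \<bar>G (2 * s)\<bar>" .
    moreover have "q * (q ^ k * \<bar>G t\<bar>) \<le> q * \<bar>G s\<bar>"
      using IH(2) q(1) by (intro mult_left_mono) auto
    ultimately have "\<bar>\<phi> (2 * s)\<bar> \<le> \<bar>\<phi> t\<bar> + \<epsilon> / 2 * \<bar>G (2 * s)\<bar> \<and> q * (q ^ k * \<bar>G t\<bar>) \<le> \<bar>G (2 * s)\<bar>"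
      using G2 by linarith
    then show ?case by (simp only: s_def power_Suc mult.assoc)
  qed (use \<epsilon> in simp)
  \<comment> \<open>The number of doublings satisfies \<open>s / (2 * T) \<le> 2 ^ k\<close>, which
    turns \<open>q ^ k\<close> into a lower bound by a power of \<open>s\<close>; the divisor
    \<open>exp 1\<close> is the loss from \<open>T\<close> to \<open>l * T\<close>.\<close>
  have bound: "\<bar>\<phi> s\<bar> \<le> D + \<epsilon> / 2 * \<bar>G s\<bar> \<and> (s / (2 * T)) powr (b / 2) * (\<bar>G T\<bar> / exp 1) \<le> \<bar>G s\<bar>"
    if sT: "s \<ge> T" for s
  proof -
    obtain k l where l: "l \<in> {1..2}" and s: "s = 2 ^ k * (l * T)"
      using obtain_dyadic_scale[OF T0(1) sT] .
    have lT: "l * T \<ge> T" using l T0 by simp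
    have 1: "\<bar>\<phi> (l * T)\<bar> \<le> D" "\<bar>G T\<bar> / exp 1 \<le> \<bar>G (l * T)\<bar>"
    proof -
      have "\<bar>\<phi> (l * T) - \<phi> T\<bar> \<le> \<delta> * \<bar>G T\<bar>" "\<bar>G T\<bar> \<le> exp 1 * \<bar>G (l * T)\<bar>"
        using T[OF order_refl] l by blast+
      then show "\<bar>\<phi> (l * T)\<bar> \<le> D" "\<bar>G T\<bar> / exp 1 \<le> \<bar>G (l * T)\<bar>"
        unfolding D_def by (linarith, simp add: divide_le_eq mult.commute)
    qed
    have "(s / (2 * T)) powr (b / 2) \<le> (2 ^ k) powr (b / 2)"
      using l T0 b by (intro powr_mono2) (simp_all add: s)
    also have "\<dots> = (2 powr real k) powr (b / 2)" by (simp add: powr_realpow)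
    also have "\<dots> = q ^ k" by (simp add: q_def powr_powr powr_power mult.commute)
    finally have "(s / (2 * T)) powr (b / 2) * (\<bar>G T\<bar> / exp 1) \<le> q ^ k * \<bar>G (l * T)\<bar>"
      using 1(2) q(1) by (intro mult_mono) auto
    with step[OF lT, of k] 1(1) show ?thesis unfolding s[symmetric] by linarith
  qed
  have "filterlim (\<lambda>s. (s / (2 * T)) powr (b / 2) * (\<bar>G T\<bar> / exp 1)) at_top at_top"
  proof (rule filterlim_at_top_mult_tendsto_pos[OF tendsto_const])
    have "filterlim (\<lambda>s. s / (2 * T)) at_top at_top"
      unfolding divide_inverse_commute by (rule filterlim_dilation) (use T0(1) in simp)
    from filterlim_compose[OF filterlim_powr_at_top[of "b / 2"] this]
    show "filterlim (\<lambda>s. (s / (2 * T)) powr (b / 2)) at_top at_top"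
      using b by simp
  qed (use T0 in simp)
  then have "\<forall>\<^sub>F s in at_top. (s / (2 * T)) powr (b / 2) * (\<bar>G T\<bar> / exp 1) \<ge> D * 2 / \<epsilon>"
    by (simp add: filterlim_at_top)
  with eventually_ge_at_top[of T]
  show "\<forall>\<^sub>F s in at_top. norm (\<phi> s) \<le> \<epsilon> * norm (G s)"
  proof eventually_elim
    case (elim s)
    then have "D * 2 / \<epsilon> \<le> \<bar>G s\<bar>" using bound[OF elim(1)] by linarith
    then have "D \<le> \<epsilon> / 2 * \<bar>G s\<bar>" using \<epsilon> by (simp add: field_simps)
    then show ?case using bound[OF elim(1)] unfolding real_norm_def by linarith
  qed
qed

end

section \<open>Reduction of the vector statement to the scalar one\<close>

lemma measurable_near_infinity_diff_inner:
  fixes f :: "real \<Rightarrow> real" and g :: "real \<Rightarrow> real ^ 'n"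
  assumes "measurable_near_infinity f" "measurable_near_infinity g"
  shows "measurable_near_infinity (\<lambda>t. f t - d \<bullet> g t)"
proof -
  obtain t1 t2 where "f \<in> borel_measurable (lebesgue_on {t1..})" "g \<in> borel_measurable (lebesgue_on {t2..})"
    using assms by (auto simp: measurable_near_infinity_def)
  then have [measurable]: "f \<in> borel_measurable (lebesgue_on {max t1 t2..})"
      "g \<in> borel_measurable (lebesgue_on {max t1 t2..})"
    by (auto elim!: measurable_restrict_mono)
  have "(\<lambda>t. f t - d \<bullet> g t) \<in> borel_measurable (lebesgue_on {max t1 t2..})"
    by measurable
  then show ?thesis unfolding measurable_near_infinity_def by (rule exI)
qed

lemma measurable_near_infinity_vec_nth:
  fixes g :: "real \<Rightarrow> real ^ 'n"
  assumes "measurable_near_infinity g"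
  shows "measurable_near_infinity (\<lambda>t. g t $ i)"
proof -
  obtain t0 where "g \<in> borel_measurable (lebesgue_on {t0..})"
    using assms by (auto simp: measurable_near_infinity_def)
  then have "(\<lambda>t. g t $ i) \<in> borel_measurable (lebesgue_on {t0..})"
    by (rule measurable_compose) (intro borel_measurable_continuous_onI continuous_intros)
  then show ?thesis unfolding measurable_near_infinity_def by (rule exI)
qed

theorem theorem7p1:
  fixes B :: "real ^ 'n::{finite,linorder} ^ 'n::{finite,linorder}"
    and g :: "real \<Rightarrow> real ^ 'n::{finite,linorder}"
    and c :: "real ^ 'n::{finite,linorder}"
    and f :: "real \<Rightarrow> real"
  assumes "index_matrix B"
    and "invertible B"
    and "regularly_varying B g"
    and "measurable_near_infinity f"
  shows "GRV B g c f \<longleftrightarrow>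
    (\<exists>C. (\<lambda>t. f t - (C + (c v* matrix_inv B) \<bullet> g t)) \<in> o[at_top](\<lambda>t. g t $ last_ix))"
proof -
  have upper: "B $ i $ j = 0" if "j < i" for i j
    using assms(1) that by (simp add: index_matrix_def)
  define b where "b = B $ last_ix $ last_ix"
  have "b \<noteq> 0"
    unfolding b_def by (rule upper_triangular_last_entry_nonzero[OF upper assms(2)])
  define G where "G t = g t $ last_ix" for t
  have rv: "(\<lambda>t. (g (x * t) - rpow_matrix x B *v g t) $ i) \<in> o[at_top](G)" if "x > 0" for x i
    using assms(3) that unfolding regularly_varying_def G_def by blast
  interpret regularly_varying_scalar G b
  proof
    have "eventually_const_sign G"
      using assms(3) unfolding regularly_varying_def rate_vector_def G_def by blast
    then show "\<forall>\<^sub>F t in at_top. G t \<noteq> 0"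
      unfolding eventually_const_sign_def by (auto elim: eventually_mono)
    show "(\<lambda>t. G (x * t) - x powr b * G t) \<in> o[at_top](G)" if "x > 0" for x
      using rv[OF that, of last_ix]
      by (simp add: rpow_matrix_mult_last[OF upper that] G_def b_def)
  qed
  define d where "d = c v* matrix_inv B"
  define \<phi> where "\<phi> t = f t - d \<bullet> g t" for t
  have meas: "measurable_near_infinity G" "measurable_near_infinity \<phi>"
    unfolding G_def \<phi>_def using assms(3,4)
    by (auto simp: regularly_varying_def intro: measurable_near_infinity_vec_nth measurable_near_infinity_diff_inner)
  have "(\<lambda>t. f (x * t) - f t - grv_h B c x \<bullet> g t) \<in> o[at_top](G) \<longleftrightarrow> (\<lambda>t. \<phi> (x * t) - \<phi> t) \<in> o[at_top](G)"
    if x: "x > 0" for x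
  proof -
    \<comment> \<open>The remainder in the regular variation of \<open>g\<close>, contracted with
      \<open>d\<close>: it is the only difference between the GRV expression for \<open>f\<close>
      and the increment of \<phi>.\<close>
    define r where "r t = d \<bullet> (g (x * t) - rpow_matrix x B *v g t)" for t
    have r: "r \<in> o[at_top](G)"
      unfolding r_def inner_vec_def
      by (intro big_sum_in_smallo) (use rv[OF x] in simp)
    have "f (x * t) - f t - grv_h B c x \<bullet> g t = (\<phi> (x * t) - \<phi> t) + r t" for t
      by (simp add: inner_grv_h[OF assms(2) x] \<phi>_def r_def d_def inner_diff_right)
    then show ?thesis
      using sum_in_smallo(1)[OF _ r, of "\<lambda>t. \<phi> (x * t) - \<phi> t"]
        sum_in_smallo(2)[OF _ r, of "\<lambda>t. \<phi> (x * t) - \<phi> t + r t"] by auto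
  qed
  then have "GRV B g c f \<longleftrightarrow> (\<forall>x>0. (\<lambda>t. \<phi> (x * t) - \<phi> t) \<in> o[at_top](G))"
    using assms(4) unfolding GRV_def G_def by blast
  also have "\<dots> \<longleftrightarrow> (\<exists>C. (\<lambda>t. \<phi> t - C) \<in> o[at_top](G))"
  proof
    assume inc: "\<forall>x>0. (\<lambda>t. \<phi> (x * t) - \<phi> t) \<in> o[at_top](G)"
    show "\<exists>C. (\<lambda>t. \<phi> t - C) \<in> o[at_top](G)"
    proof (cases "b < 0")
      case True
      then show ?thesis using asymptotically_constant_neg inc by blast
    next
      case False
      with \<open>b \<noteq> 0\<close> have "\<phi> \<in> o[at_top](G)"
        using asymptotically_zero_pos[OF _ meas] inc by simp
      \<comment> \<open>For positive \<open>b\<close> every constant is itself small relative to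
        \<open>G\<close>, so 0 serves as witness.\<close>
      then show ?thesis by (intro exI[of _ 0]) simp
    qed
  next
    assume "\<exists>C. (\<lambda>t. \<phi> t - C) \<in> o[at_top](G)"
    then show "\<forall>x>0. (\<lambda>t. \<phi> (x * t) - \<phi> t) \<in> o[at_top](G)"
      using increment_smallo_if_asymptotically_constant by blast
  qed
  finally show ?thesis
    by (simp add: \<phi>_def d_def G_def [abs_def] algebra_simps)
qed

end
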